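(* Set $$\Phi(y)=\phi_1(\rho,\theta)E_1+\phi_2(\rho,\theta)E_2+\phi_3(\rho,\theta)W,$$ with scalar functions $\phi_1,\phi_2,\phi_3$, and suppose that $L_W[\Phi]=0$. Then $\phi_1,\phi_2,\phi_3$ satisfy $$\partial_{\rho\rho}\phi_1+\frac1\rho\partial_\rho\phi_1+\frac1{\rho^2}\partial_{\theta\theta}\phi_1-\frac1{\rho^2}\phi_1+\frac{8}{(1+\rho^2)^2}\phi_1-\frac{2(\rho^2-1)}{\rho^2(\rho^2+1)}\partial_\theta\phi_2=0,$$ $$\partial_{\rho\rho}\phi_2+\frac1\rho\partial_\rho\phi_2+\frac1{\rho^2}\partial_{\theta\theta}\phi_2-\frac1{\rho^2}\phi_2+\frac{8}{(1+\rho^2)^2}\phi_2+\frac{2(\rho^2-1)}{\rho^2(\rho^2+1)}\partial_\theta\phi_1=0,$$ $$\partial_{\rho\rho}\phi_3+\frac1\rho\partial_\rho\phi_3+\frac1{\rho^2}\partial_{\theta\theta}\phi_3+\frac{8}{(1+\rho^2)^2}\phi_3=0.$$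
   Context: Polar coordinates $y=\rho e^{i\theta}\in\mathbb{R}^2\cong\mathbb{C}$; $\mathbb{R}^3\cong\mathbb{C}\times\mathbb{R}$; $\wedge$ is the cross product in $\mathbb{R}^3$. With $w(\rho)=\pi-2\arctan\rho$, $$W(y)=\begin{bmatrix}e^{i\theta}\sin w(\rho)\\ \cos w(\rho)\end{bmatrix},\quad E_1(y)=\begin{bmatrix}e^{i\theta}\cos w(\rho)\\-\sin w(\rho)\end{bmatrix},\quad E_2(y)=\begin{bmatrix}ie^{i\theta}\\0\end{bmatrix}.$$ The linearized operator is $L_W[\varphi]=\Delta_y\varphi-2W_{y_1}\wedge\varphi_{y_2}-2\varphi_{y_1}\wedge W_{y_2}$. *)

theory Defs
  imports "HOL-Analysis.Analysis"
begin

text \<open>The plane is the type of complex numbers, with y = rcis \<rho> \<theta>; the target space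
  is real^3, identified with the product of the complex plane and the real line as follows.\<close>

definition vec3 :: "complex \<Rightarrow> real \<Rightarrow> real^3" where
  "vec3 z t = vector [Re z, Im z, t]"

definition w :: "real \<Rightarrow> real" where
  "w \<rho> = pi - 2 * arctan \<rho>"

text \<open>For nonzero y the factor cis (Arg y) does not depend on the branch of the argument.
  W is smooth on the whole plane since sin (w 0) = 0, whereas E1 and E2 have no
  continuous value at the origin (there, the value given by Arg 0 = 0 is arbitrary).\<close>

definition W :: "complex \<Rightarrow> real^3" where
  "W y = vec3 (cis (Arg y) * of_real (sin (w (cmod y)))) (cos (w (cmod y)))"

definition E1 :: "complex \<Rightarrow> real^3" where
  "E1 y = vec3 (cis (Arg y) * of_real (cos (w (cmod y)))) (- sin (w (cmod y)))"

definition E2 :: "complex \<Rightarrow> real^3" where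
  "E2 y = vec3 (\<i> * cis (Arg y)) 0"

definition D1 :: "(complex \<Rightarrow> real^3) \<Rightarrow> complex \<Rightarrow> real^3" where
  "D1 f y = vector_derivative (\<lambda>t. f (y + of_real t)) (at 0)"

definition D2 :: "(complex \<Rightarrow> real^3) \<Rightarrow> complex \<Rightarrow> real^3" where
  "D2 f y = vector_derivative (\<lambda>t. f (y + \<i> * of_real t)) (at 0)"

definition laplacian :: "(complex \<Rightarrow> real^3) \<Rightarrow> complex \<Rightarrow> real^3" where
  "laplacian f y = D1 (D1 f) y + D2 (D2 f) y"

definition L_W :: "(complex \<Rightarrow> real^3) \<Rightarrow> complex \<Rightarrow> real^3" where
  "L_W \<phi> y = laplacian \<phi> y - 2 *\<^sub>R cross3 (D1 W y) (D2 \<phi> y) - 2 *\<^sub>R cross3 (D1 \<phi> y) (D2 W y)"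

text \<open>On an open set this is slightly weaker than being twice continuously differentiable:
  the map and both of its first partial derivatives are (Frechet) differentiable there.\<close>

definition twice_differentiable_on :: "(complex \<Rightarrow> real^3) \<Rightarrow> complex set \<Rightarrow> bool" where
  "twice_differentiable_on f S \<longleftrightarrow>
     f differentiable_on S \<and> D1 f differentiable_on S \<and> D2 f differentiable_on S"

definition D_rho :: "(real \<Rightarrow> real \<Rightarrow> real) \<Rightarrow> real \<Rightarrow> real \<Rightarrow> real" where
  "D_rho f \<rho> \<theta> = deriv (\<lambda>r. f r \<theta>) \<rho>"

definition D_theta :: "(real \<Rightarrow> real \<Rightarrow> real) \<Rightarrow> real \<Rightarrow> real \<Rightarrow> real" where
  "D_theta f \<rho> \<theta> = deriv (\<lambda>t. f \<rho> t) \<theta>"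

end

theory Submission
  imports Defs
begin

text \<open>
  The triple \<open>E1, E2, W\<close> is a positively oriented orthonormal frame of the target space along the
  plane, so each coefficient of \<open>\<Phi>\<close> is an inner product of \<open>\<Phi>\<close> with a frame vector, and the three
  equations are the three frame components of \<open>L_W[\<Phi>] = 0\<close> in polar coordinates. Since
  \<open>w' = - sin w / \<rho>\<close>, the frame rotates by
  \<open>\<partial>\<^sub>\<rho> E1 = (sin w / \<rho>) W\<close>, \<open>\<partial>\<^sub>\<rho> E2 = 0\<close>, \<open>\<partial>\<^sub>\<rho> W = - (sin w / \<rho>) E1\<close> and
  \<open>\<partial>\<^sub>\<theta> E1 = cos w E2\<close>, \<open>\<partial>\<^sub>\<theta> E2 = - (cos w E1 + sin w W)\<close>, \<open>\<partial>\<^sub>\<theta> W = sin w E2\<close>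
  (lemmas \<open>frame_deriv_r\<close> and \<open>frame_deriv_t\<close>).

  Both parts of the operator have a polar form. The Laplacian is
  \<open>\<partial>\<^sub>\<rho>\<^sub>\<rho> + (1/\<rho>) \<partial>\<^sub>\<rho> + (1/\<rho>\<^sup>2) \<partial>\<^sub>\<theta>\<^sub>\<theta>\<close> (lemma \<open>polar_laplacian\<close>). The wedge term
  \<open>W\<^sub>1 \<and> \<Phi>\<^sub>2 + \<Phi>\<^sub>1 \<and> W\<^sub>2\<close> is \<open>1/\<rho>\<close> times the
  same expression in \<open>\<partial>\<^sub>\<rho>\<close> and \<open>\<partial>\<^sub>\<theta>\<close> (lemma \<open>polar_cross\<close>), because it is antisymmetric in the two
  directions and so transforms by the Jacobian determinant. As \<open>\<partial>\<^sub>\<rho> W\<close> and \<open>\<partial>\<^sub>\<theta> W\<close> are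
  multiples of \<open>E1\<close> and \<open>E2\<close>, each frame component of the wedge term is a combination
  of frame components of \<open>\<partial>\<^sub>\<rho> \<Phi>\<close> and \<open>\<partial>\<^sub>\<theta> \<Phi>\<close> (lemma \<open>kernel_components\<close>).

  Differentiating each coefficient twice with the frame equations produces the components of the second
  derivatives of \<open>\<Phi>\<close> plus lower-order terms. The wedge term cancels all of those that would couple
  \<open>\<phi>3\<close> to \<open>\<phi>1\<close> and \<open>\<phi>2\<close>, and it contributes the potential. The coefficients that remain
  involve only \<open>sin w\<close> and \<open>cos w\<close>, which are rational in \<open>\<rho>\<close>: in particular
  \<open>2 sin\<^sup>2 w / \<rho>\<^sup>2 = 8 / (1 + \<rho>\<^sup>2)\<^sup>2\<close>.
\<close>

section \<open>The moving frame in polar coordinates\<close>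

text \<open>The frame is written as a function of the polar coordinates themselves: free of the
  argument function, it is smooth in the angle across the branch cut. At
  positive radius it agrees with \<open>E1\<close>, \<open>E2\<close>, \<open>W\<close>.\<close>

definition frame1 :: "real \<Rightarrow> real \<Rightarrow> real^3" where
  "frame1 r t = vec3 (cis t * of_real (cos (w r))) (- sin (w r))"

definition frame2 :: "real \<Rightarrow> real \<Rightarrow> real^3" where
  "frame2 r t = vec3 (\<i> * cis t) 0"

definition normal :: "real \<Rightarrow> real \<Rightarrow> real^3" where
  "normal r t = vec3 (cis t * of_real (sin (w r))) (cos (w r))"

lemma cis_Arg_rcis:
  assumes "r > 0"
  shows "cis (Arg (rcis r t)) = cis t"
  using assms cis_Arg[of "rcis r t"] by (simp add: rcis_def sgn_mult sgn_of_real)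

lemma frame_at_rcis:
  assumes "r > 0"
  shows "E1 (rcis r t) = frame1 r t" "E2 (rcis r t) = frame2 r t" "W (rcis r t) = normal r t"
  using assms by (simp_all add: E1_def E2_def W_def frame1_def frame2_def normal_def cis_Arg_rcis)

lemma sin_w: "sin (w r) = 2 * r / (1 + r\<^sup>2)"
proof -
  have "sin (w r) = 2 * sin (arctan r) * cos (arctan r)"
    by (simp add: w_def sin_diff sin_double)
  also have "\<dots> = 2 * r / (sqrt (1 + r\<^sup>2))\<^sup>2"
    by (simp add: sin_arctan cos_arctan power2_eq_square)
  finally show ?thesis
    by (simp add: add_nonneg_nonneg)
qed

lemma cos_w: "cos (w r) = (r\<^sup>2 - 1) / (r\<^sup>2 + 1)"
proof -
  have "cos (w r) = (sin (arctan r))\<^sup>2 - (cos (arctan r))\<^sup>2"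
    by (simp add: w_def cos_diff cos_double)
  also have "\<dots> = (r\<^sup>2 - 1) / (sqrt (1 + r\<^sup>2))\<^sup>2"
    by (simp add: sin_arctan cos_arctan power_divide diff_divide_distrib)
  finally show ?thesis
    by (simp add: add_nonneg_nonneg add.commute)
qed

text \<open>This is the equation \<open>\<rho> w' = - sin w\<close>, which keeps all later computations inside
  the functions \<open>sin w\<close> and \<open>cos w\<close>.\<close>

lemma DERIV_w:
  assumes "r > 0"
  shows "(w has_real_derivative - (sin (w r) / r)) (at r)"
proof -
  have "- (sin (w r) / r) = - 2 * inverse (1 + r\<^sup>2)"
    using assms by (simp add: sin_w divide_inverse)
  moreover have "(w has_real_derivative - 2 * inverse (1 + r\<^sup>2)) (at r)"
    unfolding w_def[abs_def] by (auto intro!: derivative_eq_intros)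
  ultimately show ?thesis by simp
qed

lemma vec3_nth [simp]: "vec3 z t $ 1 = Re z" "vec3 z t $ 2 = Im z" "vec3 z t $ 3 = t"
  by (simp_all add: vec3_def)

lemma bounded_linear_vec3: "bounded_linear (\<lambda>p. vec3 (fst p) (snd p))"
  unfolding linear_conv_bounded_linear[symmetric]
  by (rule linearI) (simp_all add: vec_eq_iff forall_3)

lemma has_vector_derivative_vec3:
  assumes "(f has_vector_derivative f') (at x)" "(g has_real_derivative g') (at x)"
  shows "((\<lambda>x. vec3 (f x) (g x)) has_vector_derivative vec3 f' g') (at x)"
  using bounded_linear.has_vector_derivative[OF bounded_linear_vec3
      has_vector_derivative_Pair[OF assms(1) assms(2)[unfolded has_real_derivative_iff_has_vector_derivative]]]
  by simp

lemma has_vector_derivative_cis: "(cis has_vector_derivative \<i> * cis t) (at t)"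
  unfolding has_vector_derivative_complex_iff
  by (auto intro!: derivative_eq_intros)

lemma frame_orthonormal:
  "frame1 r t \<bullet> frame1 r t = 1" "frame2 r t \<bullet> frame2 r t = 1" "normal r t \<bullet> normal r t = 1"
  "frame1 r t \<bullet> frame2 r t = 0" "frame1 r t \<bullet> normal r t = 0" "frame2 r t \<bullet> normal r t = 0"
proof -
  have "sin t * sin t = 1 - cos t * cos t" "sin (w r) * sin (w r) = 1 - cos (w r) * cos (w r)"
    using sin_cos_squared_add[of t] sin_cos_squared_add[of "w r"]
    by (simp_all add: power2_eq_square algebra_simps)
  then show
    "frame1 r t \<bullet> frame1 r t = 1" "frame2 r t \<bullet> frame2 r t = 1" "normal r t \<bullet> normal r t = 1"
    "frame1 r t \<bullet> frame2 r t = 0" "frame1 r t \<bullet> normal r t = 0" "frame2 r t \<bullet> normal r t = 0"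
    unfolding frame1_def frame2_def normal_def inner_vec_def sum_3 by (simp; algebra)+
qed

lemma frame_cross:
  "cross3 (frame1 r t) (frame2 r t) = normal r t"
  "cross3 (frame2 r t) (normal r t) = frame1 r t"
  "cross3 (normal r t) (frame1 r t) = frame2 r t"
proof -
  have "sin t * sin t = 1 - cos t * cos t" "sin (w r) * sin (w r) = 1 - cos (w r) * cos (w r)"
    using sin_cos_squared_add[of t] sin_cos_squared_add[of "w r"]
    by (simp_all add: power2_eq_square algebra_simps)
  then show
  "cross3 (frame1 r t) (frame2 r t) = normal r t"
  "cross3 (frame2 r t) (normal r t) = frame1 r t"
  "cross3 (normal r t) (frame1 r t) = frame2 r t"
    unfolding frame1_def frame2_def normal_def vec_eq_iff forall_3
    by (simp_all add: cross3_simps; algebra)+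
qed

lemma frame_deriv_r:
  assumes "r > 0"
  shows "((\<lambda>r. frame1 r t) has_vector_derivative (sin (w r) / r) *\<^sub>R normal r t) (at r)"
    and "((\<lambda>r. frame2 r t) has_vector_derivative 0) (at r)"
    and "((\<lambda>r. normal r t) has_vector_derivative - (sin (w r) / r) *\<^sub>R frame1 r t) (at r)"
proof -
  have c: "((\<lambda>r. cos (w r)) has_real_derivative sin (w r) / r * sin (w r)) (at r)"
    and s: "((\<lambda>r. sin (w r)) has_real_derivative - (sin (w r) / r) * cos (w r)) (at r)"
    using DERIV_w[OF assms] by (auto intro!: derivative_eq_intros)
  have of_real: "((\<lambda>r. cis t * of_real (g r)) has_vector_derivative cis t * of_real g') (at r)"
    if "(g has_real_derivative g') (at r)" for g g'
    by (intro has_vector_derivative_mult_right has_vector_derivative_of_real that)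
  show "((\<lambda>r. frame1 r t) has_vector_derivative (sin (w r) / r) *\<^sub>R normal r t) (at r)"
    unfolding frame1_def normal_def
    by (rule has_vector_derivative_eq_rhs[OF has_vector_derivative_vec3[OF of_real[OF c] DERIV_minus[OF s]]])
       (simp add: vec_eq_iff forall_3)
  show "((\<lambda>r. normal r t) has_vector_derivative - (sin (w r) / r) *\<^sub>R frame1 r t) (at r)"
    unfolding frame1_def normal_def
    by (rule has_vector_derivative_eq_rhs[OF has_vector_derivative_vec3[OF of_real[OF s] c]])
       (simp add: vec_eq_iff forall_3)
  show "((\<lambda>r. frame2 r t) has_vector_derivative 0) (at r)"
    unfolding frame2_def by simp
qed

lemma frame_deriv_t:
  "(frame1 r has_vector_derivative cos (w r) *\<^sub>R frame2 r t) (at t)"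
  "(frame2 r has_vector_derivative - (cos (w r) *\<^sub>R frame1 r t + sin (w r) *\<^sub>R normal r t)) (at t)"
  "(normal r has_vector_derivative sin (w r) *\<^sub>R frame2 r t) (at t)"
proof -
  have e: "sin (w r) * sin (w r) = 1 - cos (w r) * cos (w r)"
    using sin_cos_squared_add[of "w r"]
    by (simp_all add: power2_eq_square algebra_simps)
  show "(frame1 r has_vector_derivative cos (w r) *\<^sub>R frame2 r t) (at t)"
    unfolding frame1_def[abs_def] frame2_def
    by (rule has_vector_derivative_eq_rhs, rule has_vector_derivative_vec3,
      (rule has_vector_derivative_mult_left has_vector_derivative_cis derivative_intros)+)
     (simp add: vec_eq_iff forall_3)
  show "(normal r has_vector_derivative sin (w r) *\<^sub>R frame2 r t) (at t)"
    unfolding normal_def[abs_def] frame2_def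
    by (rule has_vector_derivative_eq_rhs, rule has_vector_derivative_vec3,
      (rule has_vector_derivative_mult_left has_vector_derivative_cis derivative_intros)+)
     (simp add: vec_eq_iff forall_3)
  show "(frame2 r has_vector_derivative - (cos (w r) *\<^sub>R frame1 r t + sin (w r) *\<^sub>R normal r t)) (at t)"
    unfolding normal_def frame1_def frame2_def[abs_def]
    apply (rule has_vector_derivative_eq_rhs, rule has_vector_derivative_vec3,
      (rule has_vector_derivative_mult_right has_vector_derivative_cis derivative_intros)+)
    using e by (simp add: vec_eq_iff forall_3; algebra)
qed

section \<open>Derivatives in polar directions\<close>

text \<open>Here \<open>cis (Arg y)\<close> combines with the factor \<open>cmod y\<close> of \<open>sin (w (cmod y))\<close> to give \<open>y\<close>, so
  \<open>W\<close> is the inverse stereographic projection, rational in the coordinates of \<open>y\<close> and differentiable also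
  across the branch cut of the argument.\<close>

lemma W_differentiable:
  assumes "y \<noteq> 0"
  shows "W differentiable (at y)"
proof -
  have eq: "W = (\<lambda>y. vec3 ((2 / (1 + y \<bullet> y)) *\<^sub>R y) ((y \<bullet> y - 1) / (y \<bullet> y + 1)))"
  proof
    fix y
    have "cis (Arg y) * of_real (cmod y) = y"
      by (metis rcis_cmod_Arg rcis_def mult.commute)
    moreover have "cis (Arg y) * of_real (2 * cmod y / (1 + (cmod y)\<^sup>2))
        = of_real (2 / (1 + (cmod y)\<^sup>2)) * (cis (Arg y) * of_real (cmod y))"
      by simp
    ultimately have "cis (Arg y) * of_real (2 * cmod y / (1 + (cmod y)\<^sup>2))
        = of_real (2 / (1 + (cmod y)\<^sup>2)) * y"
      by (simp only:)
    then show "W y = vec3 ((2 / (1 + y \<bullet> y)) *\<^sub>R y) ((y \<bullet> y - 1) / (y \<bullet> y + 1))"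
      unfolding W_def sin_w cos_w by (simp only: power2_norm_eq_inner scaleR_conv_of_real)
  qed
  have nz: "1 + y \<bullet> y \<noteq> 0" "y \<bullet> y + 1 \<noteq> 0"
    using inner_ge_zero[of y] by linarith+
  have "(\<lambda>y::complex. (2 / (1 + y \<bullet> y)) *\<^sub>R y) differentiable (at y)"
    unfolding differentiable_def using nz
    by (auto intro!: derivative_eq_intros exI)
  moreover have "(\<lambda>y::complex. (y \<bullet> y - 1) / (y \<bullet> y + 1)) differentiable (at y)"
    unfolding differentiable_def using nz
    by (auto intro!: derivative_eq_intros exI)
  ultimately show ?thesis
    unfolding eq differentiable_def
    using bounded_linear.has_derivative[OF bounded_linear_vec3 has_derivative_Pair]
    by fastforce
qed

lemma has_vector_derivative_rcis_r: "((\<lambda>r. rcis r t) has_vector_derivative cis t) (at r)"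
  unfolding has_vector_derivative_complex_iff
  by (auto intro!: derivative_eq_intros)

lemma has_vector_derivative_rcis_t: "((\<lambda>t. rcis r t) has_vector_derivative \<i> * rcis r t) (at t)"
  unfolding has_vector_derivative_complex_iff
  by (auto intro!: derivative_eq_intros)

lemma has_derivative_D1_D2:
  assumes "f differentiable (at y)"
  shows "(f has_derivative (\<lambda>h. Re h *\<^sub>R D1 f y + Im h *\<^sub>R D2 f y)) (at y)"
proof -
  obtain F where F: "(f has_derivative F) (at y)"
    using assms unfolding differentiable_def by blast
  have lin: "linear F" using F has_derivative_linear by blast
  have along: "vector_derivative (\<lambda>t. f (y + h * of_real t)) (at 0) = F h" for h
  proof -
    have 1: "((\<lambda>t. y + h * of_real t) has_vector_derivative h) (at 0)"
      by (rule has_vector_derivative_eq_rhs, (rule derivative_intros)+) simp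
    have "(f has_derivative F) (at ((\<lambda>t. y + h * of_real t) 0))" using F by simp
    from vector_derivative_diff_chain_within[of "\<lambda>t. y + h * of_real t" h 0 UNIV f F] 1 this
    show ?thesis
      by (intro vector_derivative_at) (simp add: o_def has_derivative_at_withinI)
  qed
  have "F h = Re h *\<^sub>R D1 f y + Im h *\<^sub>R D2 f y" for h
  proof -
    have "F h = F (Re h *\<^sub>R 1 + Im h *\<^sub>R \<i>)"
      by (rule arg_cong[of _ _ F]) (simp add: complex_eq_iff)
    also have "\<dots> = Re h *\<^sub>R F 1 + Im h *\<^sub>R F \<i>"
      using lin by (simp only: linear_add linear_scale)
    finally show ?thesis
      using along[of 1] along[of \<i>] by (simp add: D1_def D2_def)
  qed
  then have "F = (\<lambda>h. Re h *\<^sub>R D1 f y + Im h *\<^sub>R D2 f y)" by blast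
  with F show ?thesis by simp
qed


text \<open>The partial derivatives of \<open>f\<close> in polar coordinates, expressed by the Cartesian ones so that
  they can be differentiated once more by the chain rule.\<close>

definition radial :: "(complex \<Rightarrow> real^3) \<Rightarrow> real \<Rightarrow> real \<Rightarrow> real^3" where
  "radial f r t = cos t *\<^sub>R D1 f (rcis r t) + sin t *\<^sub>R D2 f (rcis r t)"

definition angular :: "(complex \<Rightarrow> real^3) \<Rightarrow> real \<Rightarrow> real \<Rightarrow> real^3" where
  "angular f r t = r *\<^sub>R (cos t *\<^sub>R D2 f (rcis r t) - sin t *\<^sub>R D1 f (rcis r t))"

lemma polar_chain_rule:
  assumes "f differentiable (at (rcis r t))"
  shows "((\<lambda>r. f (rcis r t)) has_vector_derivative radial f r t) (at r)"
    and "((\<lambda>t. f (rcis r t)) has_vector_derivative angular f r t) (at t)"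
proof -
  note D = has_derivative_D1_D2[OF assms]
  show "((\<lambda>r. f (rcis r t)) has_vector_derivative radial f r t) (at r)"
    using vector_derivative_diff_chain_within[of "\<lambda>r. rcis r t" _ r UNIV f,
        OF has_vector_derivative_rcis_r has_derivative_at_withinI[OF D]]
    by (simp add: radial_def o_def)
  show "((\<lambda>t. f (rcis r t)) has_vector_derivative angular f r t) (at t)"
    using vector_derivative_diff_chain_within[of "\<lambda>t. rcis r t" _ t UNIV f,
        OF has_vector_derivative_rcis_t has_derivative_at_withinI[OF D]]
    by (simp add: angular_def o_def algebra_simps)
qed

text \<open>The mixed derivatives \<open>D1 (D2 f)\<close> and \<open>D2 (D1 f)\<close> enter the radial and the angular part with
  opposite signs and cancel one by one. The term
  \<open>(1/r) \<partial>\<^sub>r f\<close> offsets the derivatives of \<open>cos t\<close> and \<open>sin t\<close> in the angular part.\<close>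

lemma polar_laplacian:
  assumes "r \<noteq> 0"
    and "D1 f differentiable (at (rcis r t))" "D2 f differentiable (at (rcis r t))"
  obtains rr tt where
    "((\<lambda>r. radial f r t) has_vector_derivative rr) (at r)"
    "(angular f r has_vector_derivative tt) (at t)"
    "rr + (1 / r) *\<^sub>R radial f r t + (1 / r\<^sup>2) *\<^sub>R tt = laplacian f (rcis r t)"
proof -
  let ?y = "rcis r t"
  let ?rr = "cos t *\<^sub>R radial (D1 f) r t + sin t *\<^sub>R radial (D2 f) r t"
  let ?tt = "r *\<^sub>R (cos t *\<^sub>R angular (D2 f) r t - sin t *\<^sub>R D2 f ?y
                 - (sin t *\<^sub>R angular (D1 f) r t + cos t *\<^sub>R D1 f ?y))"
  show ?thesis
  proof
    show "((\<lambda>r. radial f r t) has_vector_derivative ?rr) (at r)"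
      unfolding radial_def[of f]
      by (intro has_vector_derivative_add polar_chain_rule assms
          bounded_linear.has_vector_derivative[OF bounded_linear_scaleR_right])
    have 1: "((\<lambda>t. cos t *\<^sub>R D2 f (rcis r t)) has_vector_derivative
          cos t *\<^sub>R angular (D2 f) r t + (- sin t) *\<^sub>R D2 f ?y) (at t)"
      by (rule has_vector_derivative_scaleR[OF DERIV_cos polar_chain_rule(2)[OF assms(3)]])
    have 2: "((\<lambda>t. sin t *\<^sub>R D1 f (rcis r t)) has_vector_derivative
          sin t *\<^sub>R angular (D1 f) r t + cos t *\<^sub>R D1 f ?y) (at t)"
      by (rule has_vector_derivative_scaleR[OF DERIV_sin polar_chain_rule(2)[OF assms(2)]])
    show "(angular f r has_vector_derivative ?tt) (at t)"
      using bounded_linear.has_vector_derivative[OF bounded_linear_scaleR_right has_vector_derivative_diff[OF 1 2], of r]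
      unfolding angular_def[of f, abs_def] by simp
    have e: "sin t * sin t = 1 - cos t * cos t"
      using sin_cos_squared_add[of t] by (simp add: power2_eq_square algebra_simps)
    show "?rr + (1 / r) *\<^sub>R radial f r t + (1 / r\<^sup>2) *\<^sub>R ?tt = laplacian f ?y"
      using assms(1) unfolding radial_def angular_def laplacian_def vec_eq_iff
      by (intro allI, simp add: field_simps power2_eq_square, insert e, algebra)
  qed
qed

text \<open>The left side is antisymmetric under exchange of the two coordinate directions, hence
  a change of coordinates multiplies it by a determinant, here \<open>\<partial>(r, t) / \<partial>(y\<^sub>1, y\<^sub>2) = 1/r\<close>.\<close>

lemma polar_cross:
  assumes "r \<noteq> 0"
  shows "cross3 (D1 g (rcis r t)) (D2 f (rcis r t)) + cross3 (D1 f (rcis r t)) (D2 g (rcis r t))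
     = (1 / r) *\<^sub>R (cross3 (radial g r t) (angular f r t) + cross3 (radial f r t) (angular g r t))"
proof -
  have e: "sin t * sin t = 1 - cos t * cos t"
    using sin_cos_squared_add[of t] by (simp add: power2_eq_square algebra_simps)
  show ?thesis
    using assms e unfolding radial_def angular_def vec_eq_iff forall_3
    by (intro conjI; simp add: cross_components field_simps; algebra)
qed

lemma W_polar_derivs:
  assumes "r > 0"
  shows "radial W r t = - (sin (w r) / r) *\<^sub>R frame1 r t"
    and "angular W r t = sin (w r) *\<^sub>R frame2 r t"
proof -
  have d: "W differentiable (at (rcis r t))"
    using assms by (intro W_differentiable) (simp add: rcis_def)
  have "((\<lambda>r. W (rcis r t)) has_vector_derivative - (sin (w r) / r) *\<^sub>R frame1 r t) (at r)"
    by (rule has_vector_derivative_transform_within_open[OF frame_deriv_r(3)[OF assms], of "{0<..}"])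
       (use assms in \<open>auto simp: frame_at_rcis\<close>)
  then show "radial W r t = - (sin (w r) / r) *\<^sub>R frame1 r t"
    using polar_chain_rule(1)[OF d] vector_derivative_unique_at by blast
  show "angular W r t = sin (w r) *\<^sub>R frame2 r t"
    using polar_chain_rule(2)[OF d] frame_deriv_t(3)[of r t] vector_derivative_unique_at assms
    by (auto simp: frame_at_rcis)
qed

section \<open>Frame components of the kernel equation\<close>

lemma kernel_polar:
  assumes "r > 0" and "L_W f (rcis r t) = 0"
  shows "laplacian f (rcis r t) =
    (2 * sin (w r) / r) *\<^sub>R cross3 (radial f r t) (frame2 r t)
    - (2 * sin (w r) / r\<^sup>2) *\<^sub>R cross3 (frame1 r t) (angular f r t)"
proof -
  have "laplacian f (rcis r t) =
      2 *\<^sub>R (cross3 (D1 W (rcis r t)) (D2 f (rcis r t)) + cross3 (D1 f (rcis r t)) (D2 W (rcis r t)))"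
    using assms(2) unfolding L_W_def by (simp add: algebra_simps)
  also have "\<dots> = 2 *\<^sub>R ((1 / r) *\<^sub>R
      (cross3 (- (sin (w r) / r) *\<^sub>R frame1 r t) (angular f r t)
        + cross3 (radial f r t) (sin (w r) *\<^sub>R frame2 r t)))"
    using assms(1) by (simp only: polar_cross[of r W t f] W_polar_derivs[OF assms(1)])
  finally show ?thesis
    by (simp add: cross_mult_left cross_mult_right scaleR_right_distrib
        scaleR_right_diff_distrib power2_eq_square)
qed

text \<open>Moving the cyclic triple product onto the two frame vectors turns every cross product
  with an unknown derivative into one of its frame components.\<close>

lemma kernel_components:
  assumes "r > 0" and "L_W f (rcis r t) = 0"
  shows "laplacian f (rcis r t) \<bullet> frame1 r t = - (2 * sin (w r) / r) * (radial f r t \<bullet> normal r t)"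
    and "laplacian f (rcis r t) \<bullet> frame2 r t = (2 * sin (w r) / r\<^sup>2) * (angular f r t \<bullet> normal r t)"
    and "laplacian f (rcis r t) \<bullet> normal r t =
      (2 * sin (w r) / r) * (radial f r t \<bullet> frame1 r t)
      - (2 * sin (w r) / r\<^sup>2) * (angular f r t \<bullet> frame2 r t)"
proof -
  have cyc: "cross3 a b \<bullet> c = a \<bullet> cross3 b c" "cross3 a b \<bullet> c = b \<bullet> cross3 c a" for a b c
    unfolding inner_vec_def sum_3 cross_components by (simp_all add: algebra_simps)
  have c: "cross3 (frame2 r t) (frame1 r t) = - normal r t"
    "cross3 (frame2 r t) (normal r t) = frame1 r t"
    "cross3 (normal r t) (frame1 r t) = frame2 r t"
    using frame_cross[of r t] cross_skew[of "frame2 r t" "frame1 r t"] by simp_all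
  note k = kernel_polar[OF assms]
  show "laplacian f (rcis r t) \<bullet> frame1 r t = - (2 * sin (w r) / r) * (radial f r t \<bullet> normal r t)"
    unfolding k inner_diff_left inner_scaleR_left
      cyc(1)[of "radial f r t"] cyc(2)[of "frame1 r t"] c by simp
  show "laplacian f (rcis r t) \<bullet> frame2 r t = (2 * sin (w r) / r\<^sup>2) * (angular f r t \<bullet> normal r t)"
    unfolding k inner_diff_left inner_scaleR_left
      cyc(1)[of "radial f r t"] cyc(2)[of "frame1 r t"] c by simp
  show "laplacian f (rcis r t) \<bullet> normal r t =
      (2 * sin (w r) / r) * (radial f r t \<bullet> frame1 r t)
      - (2 * sin (w r) / r\<^sup>2) * (angular f r t \<bullet> frame2 r t)"
    unfolding k inner_diff_left inner_scaleR_left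
      cyc(1)[of "radial f r t"] cyc(2)[of "frame1 r t"] c by simp
qed

lemma has_real_derivative_inner:
  assumes "(f has_vector_derivative f') (at x)" "(g has_vector_derivative g') (at x)"
  shows "((\<lambda>x. f x \<bullet> g x) has_real_derivative f' \<bullet> g x + f x \<bullet> g') (at x)"
proof -
  have "(\<lambda>h. f x \<bullet> (h *\<^sub>R g') + (h *\<^sub>R f') \<bullet> g x) = (*) (f' \<bullet> g x + f x \<bullet> g')"
    by (rule ext) (simp only: inner_scaleR_left inner_scaleR_right ring_distribs ac_simps)
  then show ?thesis
    using has_derivative_inner[OF assms[unfolded has_vector_derivative_def]]
    unfolding has_field_derivative_def by metis
qed

text \<open>The frame derivatives turn the derivative of a component of \<open>Q\<close> into components of \<open>Q\<close> and
  \<open>Q'\<close>. The rules apply both to \<open>\<Phi>\<close> and to its polar derivatives, which gives the second derivatives of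
  the coefficients.\<close>

lemma component_deriv_r:
  assumes "(Q has_vector_derivative Q') (at r)" "r > 0"
  shows "((\<lambda>r. Q r \<bullet> frame1 r t) has_real_derivative
            Q' \<bullet> frame1 r t + sin (w r) / r * (Q r \<bullet> normal r t)) (at r)"
    and "((\<lambda>r. Q r \<bullet> frame2 r t) has_real_derivative Q' \<bullet> frame2 r t) (at r)"
    and "((\<lambda>r. Q r \<bullet> normal r t) has_real_derivative
            Q' \<bullet> normal r t - sin (w r) / r * (Q r \<bullet> frame1 r t)) (at r)"
  using has_real_derivative_inner[OF assms(1) frame_deriv_r(1)[OF assms(2), of t]]
    has_real_derivative_inner[OF assms(1) frame_deriv_r(2)[OF assms(2), of t]]
    has_real_derivative_inner[OF assms(1) frame_deriv_r(3)[OF assms(2), of t]]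
  by simp_all

lemma component_deriv_t:
  assumes "(Q has_vector_derivative Q') (at t)"
  shows "((\<lambda>t. Q t \<bullet> frame1 r t) has_real_derivative
            Q' \<bullet> frame1 r t + cos (w r) * (Q t \<bullet> frame2 r t)) (at t)"
    and "((\<lambda>t. Q t \<bullet> frame2 r t) has_real_derivative
            Q' \<bullet> frame2 r t - cos (w r) * (Q t \<bullet> frame1 r t) - sin (w r) * (Q t \<bullet> normal r t)) (at t)"
    and "((\<lambda>t. Q t \<bullet> normal r t) has_real_derivative
            Q' \<bullet> normal r t + sin (w r) * (Q t \<bullet> frame2 r t)) (at t)"
  using has_real_derivative_inner[OF assms(1) frame_deriv_t(1)[of r t]]
    has_real_derivative_inner[OF assms(1) frame_deriv_t(2)[of r t]]
    has_real_derivative_inner[OF assms(1) frame_deriv_t(3)[of r t]]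
  by (simp_all add: inner_diff_right inner_add_right algebra_simps)

lemma DERIV_cong_positive:
  fixes f g :: "real \<Rightarrow> real"
  assumes "(f has_real_derivative d) (at r)" and "\<And>r. r > 0 \<Longrightarrow> f r = g r" and "r > 0"
  shows "(g has_real_derivative d) (at r)"
  by (rule has_field_derivative_transform_within_open[OF assms(1), of "{0<..}"])
     (use assms(2,3) in auto)

text \<open>A formula for the first radial derivative on the whole ray \<open>r > 0\<close> determines the second one at
  each of its points. On the rest of the real line nothing is known about \<open>f\<close>.\<close>

lemma D_rho_eqI:
  assumes "\<And>r. r > 0 \<Longrightarrow> ((\<lambda>r. f r t) has_real_derivative g r) (at r)"
    and "(g has_real_derivative d) (at r)" and "r > 0"
  shows "D_rho f r t = g r" "D_rho (D_rho f) r t = d"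
proof -
  have f: "D_rho f r t = g r" if "r > 0" for r
    unfolding D_rho_def by (rule DERIV_imp_deriv[OF assms(1)[OF that]])
  then show "D_rho f r t = g r" using assms(3) .
  show "D_rho (D_rho f) r t = d"
    unfolding D_rho_def[of "D_rho f"]
    by (rule DERIV_imp_deriv[OF DERIV_cong_positive[OF assms(2) f[symmetric] assms(3)]])
qed

lemma D_theta_eqI:
  assumes "\<And>t. (f r has_real_derivative g t) (at t)" and "(g has_real_derivative d) (at t)"
  shows "D_theta f r t = g t" "D_theta (D_theta f) r t = d"
proof -
  have f: "D_theta f r = g"
    unfolding D_theta_def using DERIV_imp_deriv[OF assms(1)] by blast
  then show "D_theta f r t = g t" by simp
  show "D_theta (D_theta f) r t = d"
    unfolding D_theta_def[of "D_theta f"] f by (rule DERIV_imp_deriv[OF assms(2)])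
qed

section \<open>The equations for the coefficients\<close>

theorem lemma2p1:
  fixes \<Phi> :: "complex \<Rightarrow> real^3"
    and \<phi>1 \<phi>2 \<phi>3 :: "real \<Rightarrow> real \<Rightarrow> real"
  assumes Phi: "\<And>\<rho> \<theta>. \<rho> > 0 \<Longrightarrow>
      \<Phi> (rcis \<rho> \<theta>) = \<phi>1 \<rho> \<theta> *\<^sub>R E1 (rcis \<rho> \<theta>) + \<phi>2 \<rho> \<theta> *\<^sub>R E2 (rcis \<rho> \<theta>)
                    + \<phi>3 \<rho> \<theta> *\<^sub>R W (rcis \<rho> \<theta>)"
    and reg: "twice_differentiable_on \<Phi> (- {0})"
    and kernel: "\<And>y. y \<noteq> 0 \<Longrightarrow> L_W \<Phi> y = 0"
  shows "\<forall>\<rho> \<theta>. \<rho> > 0 \<longrightarrow>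
      D_rho (D_rho \<phi>1) \<rho> \<theta> + 1 / \<rho> * D_rho \<phi>1 \<rho> \<theta> + 1 / \<rho>\<^sup>2 * D_theta (D_theta \<phi>1) \<rho> \<theta>
        - 1 / \<rho>\<^sup>2 * \<phi>1 \<rho> \<theta> + 8 / (1 + \<rho>\<^sup>2)\<^sup>2 * \<phi>1 \<rho> \<theta>
        - 2 * (\<rho>\<^sup>2 - 1) / (\<rho>\<^sup>2 * (\<rho>\<^sup>2 + 1)) * D_theta \<phi>2 \<rho> \<theta> = 0
    \<and> D_rho (D_rho \<phi>2) \<rho> \<theta> + 1 / \<rho> * D_rho \<phi>2 \<rho> \<theta> + 1 / \<rho>\<^sup>2 * D_theta (D_theta \<phi>2) \<rho> \<theta>
        - 1 / \<rho>\<^sup>2 * \<phi>2 \<rho> \<theta> + 8 / (1 + \<rho>\<^sup>2)\<^sup>2 * \<phi>2 \<rho> \<theta>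
        + 2 * (\<rho>\<^sup>2 - 1) / (\<rho>\<^sup>2 * (\<rho>\<^sup>2 + 1)) * D_theta \<phi>1 \<rho> \<theta> = 0
    \<and> D_rho (D_rho \<phi>3) \<rho> \<theta> + 1 / \<rho> * D_rho \<phi>3 \<rho> \<theta> + 1 / \<rho>\<^sup>2 * D_theta (D_theta \<phi>3) \<rho> \<theta>
        + 8 / (1 + \<rho>\<^sup>2)\<^sup>2 * \<phi>3 \<rho> \<theta> = 0"
proof (intro allI impI)
  fix r t :: real
  assume r: "r > 0"
  define P where "P r t = \<Phi> (rcis r t)" for r t
  define Pr where "Pr = radial \<Phi>"
  define Pt where "Pt = angular \<Phi>"
  have \<Phi>_diff: "\<Phi> differentiable (at y)" "D1 \<Phi> differentiable (at y)" "D2 \<Phi> differentiable (at y)"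
    if "y \<noteq> 0" for y
    using reg that unfolding twice_differentiable_on_def
    by (auto simp: open_Compl differentiable_on_eq_differentiable_at)
  have P_r: "((\<lambda>r. P r t) has_vector_derivative Pr r t) (at r)"
    and P_t: "(P r has_vector_derivative Pt r t) (at t)" if "r > 0" for r t
    using that polar_chain_rule[OF \<Phi>_diff(1), of r t] unfolding P_def Pr_def Pt_def by auto
  have P_expand: "P r t = \<phi>1 r t *\<^sub>R frame1 r t + \<phi>2 r t *\<^sub>R frame2 r t + \<phi>3 r t *\<^sub>R normal r t"
    if "r > 0" for r t
    unfolding P_def Phi[OF that] frame_at_rcis[OF that] ..
  have comp: "\<phi>1 r t = P r t \<bullet> frame1 r t" "\<phi>2 r t = P r t \<bullet> frame2 r t" "\<phi>3 r t = P r t \<bullet> normal r t"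
    if "r > 0" for r t
    unfolding P_expand[OF that]
    using frame_orthonormal[of r t] frame_orthonormal(4-6)[of r t, THEN trans[OF inner_commute]]
    by (simp_all add: inner_add_left)
  have rnz: "rcis r t \<noteq> 0" "r \<noteq> 0" using r by (auto simp: rcis_def)
  obtain rr tt where P_rr: "((\<lambda>r. Pr r t) has_vector_derivative rr) (at r)"
    and P_tt: "(Pt r has_vector_derivative tt) (at t)"
    and lap: "rr + (1 / r) *\<^sub>R Pr r t + (1 / r\<^sup>2) *\<^sub>R tt = laplacian \<Phi> (rcis r t)"
    using polar_laplacian[OF rnz(2) \<Phi>_diff(2,3)[OF rnz(1)]] unfolding Pr_def Pt_def by metis
  define s where "s = sin (w r)"
  define c where "c = cos (w r)"
  have s_sq: "s * s = 1 - c * c"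
    using sin_cos_squared_add[of "w r"] by (simp add: s_def c_def power2_eq_square algebra_simps)
  note K = kernel_components[OF r kernel[OF rnz(1)], folded lap Pr_def Pt_def s_def,
      unfolded inner_add_left inner_scaleR_left]
  \<comment> \<open>The rotation rate of the frame in the radial direction depends on the radius, so it contributes
    its own derivative to the second radial derivatives.\<close>
  have k: "((\<lambda>r. sin (w r) / r) has_real_derivative - s * (c + 1) / r\<^sup>2) (at r)"
    using DERIV_w[OF r] rnz(2) unfolding s_def c_def
    by (auto intro!: derivative_eq_intros simp: field_simps power2_eq_square)
  have \<phi>_r:
    "((\<lambda>r. \<phi>1 r t) has_real_derivative Pr r t \<bullet> frame1 r t + sin (w r) / r * \<phi>3 r t) (at r)"
    "((\<lambda>r. \<phi>2 r t) has_real_derivative Pr r t \<bullet> frame2 r t) (at r)"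
    "((\<lambda>r. \<phi>3 r t) has_real_derivative Pr r t \<bullet> normal r t - sin (w r) / r * \<phi>1 r t) (at r)"
    if "r > 0" for r t
    using DERIV_cong_positive[OF component_deriv_r(1)[OF P_r[OF that] that, of t] comp(1)[symmetric] that]
      DERIV_cong_positive[OF component_deriv_r(2)[OF P_r[OF that] that, of t] comp(2)[symmetric] that]
      DERIV_cong_positive[OF component_deriv_r(3)[OF P_r[OF that] that, of t] comp(3)[symmetric] that]
    unfolding comp[OF that, symmetric] by blast+
  have \<phi>_rr:
    "((\<lambda>r. Pr r t \<bullet> frame1 r t + sin (w r) / r * \<phi>3 r t) has_real_derivative
       rr \<bullet> frame1 r t + s / r * (Pr r t \<bullet> normal r t)
       + (- s * (c + 1) / r\<^sup>2 * \<phi>3 r t + (Pr r t \<bullet> normal r t - s / r * \<phi>1 r t) * (s / r))) (at r)"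
    "((\<lambda>r. Pr r t \<bullet> frame2 r t) has_real_derivative rr \<bullet> frame2 r t) (at r)"
    "((\<lambda>r. Pr r t \<bullet> normal r t - sin (w r) / r * \<phi>1 r t) has_real_derivative
       rr \<bullet> normal r t - s / r * (Pr r t \<bullet> frame1 r t)
       - (- s * (c + 1) / r\<^sup>2 * \<phi>1 r t + (Pr r t \<bullet> frame1 r t + s / r * \<phi>3 r t) * (s / r))) (at r)"
    using DERIV_add[OF component_deriv_r(1)[OF P_rr r, where t = t] DERIV_mult[OF k \<phi>_r(3)[OF r, of t]]]
      component_deriv_r(2)[OF P_rr r, where t = t]
      DERIV_diff[OF component_deriv_r(3)[OF P_rr r, where t = t] DERIV_mult[OF k \<phi>_r(1)[OF r, of t]]]
    unfolding s_def[symmetric] .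
  have \<phi>_t:
    "(\<phi>1 r has_real_derivative Pt r t \<bullet> frame1 r t + c * \<phi>2 r t) (at t)"
    "(\<phi>2 r has_real_derivative Pt r t \<bullet> frame2 r t - c * \<phi>1 r t - s * \<phi>3 r t) (at t)"
    "(\<phi>3 r has_real_derivative Pt r t \<bullet> normal r t + s * \<phi>2 r t) (at t)" for t
    using component_deriv_t[OF P_t[OF r], of r t] unfolding comp[OF r, symmetric] s_def c_def by blast+
  have \<phi>_tt:
    "((\<lambda>t. Pt r t \<bullet> frame1 r t + c * \<phi>2 r t) has_real_derivative
       tt \<bullet> frame1 r t + c * (Pt r t \<bullet> frame2 r t)
       + c * (Pt r t \<bullet> frame2 r t - c * \<phi>1 r t - s * \<phi>3 r t)) (at t)"
    "((\<lambda>t. Pt r t \<bullet> frame2 r t - c * \<phi>1 r t - s * \<phi>3 r t) has_real_derivative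
       tt \<bullet> frame2 r t - c * (Pt r t \<bullet> frame1 r t) - s * (Pt r t \<bullet> normal r t)
       - c * (Pt r t \<bullet> frame1 r t + c * \<phi>2 r t) - s * (Pt r t \<bullet> normal r t + s * \<phi>2 r t)) (at t)"
    "((\<lambda>t. Pt r t \<bullet> normal r t + s * \<phi>2 r t) has_real_derivative
       tt \<bullet> normal r t + s * (Pt r t \<bullet> frame2 r t)
       + s * (Pt r t \<bullet> frame2 r t - c * \<phi>1 r t - s * \<phi>3 r t)) (at t)"
    by (intro DERIV_add DERIV_diff DERIV_cmult \<phi>_t
        component_deriv_t[OF P_tt, of r, folded s_def c_def])+
  note derivs =
    D_rho_eqI[of \<phi>1 t, OF \<phi>_r(1) \<phi>_rr(1) r]
    D_rho_eqI[of \<phi>2 t, OF \<phi>_r(2) \<phi>_rr(2) r]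
    D_rho_eqI[of \<phi>3 t, OF \<phi>_r(3) \<phi>_rr(3) r]
    D_theta_eqI[of \<phi>1, OF \<phi>_t(1) \<phi>_tt(1)] D_theta_eqI[of \<phi>2, OF \<phi>_t(2) \<phi>_tt(2)]
    D_theta_eqI[of \<phi>3, OF \<phi>_t(3) \<phi>_tt(3)]
  have pos: "1 + r\<^sup>2 > 0" by (simp add: add_pos_nonneg)
  have coeff: "8 / (1 + r\<^sup>2)\<^sup>2 = 2 * s\<^sup>2 / r\<^sup>2"
    "2 * (r\<^sup>2 - 1) / (r\<^sup>2 * (r\<^sup>2 + 1)) = 2 * c / r\<^sup>2"
    using rnz(2) pos unfolding s_def c_def sin_w cos_w by (simp_all add: field_simps)
  show "D_rho (D_rho \<phi>1) r t + 1 / r * D_rho \<phi>1 r t + 1 / r\<^sup>2 * D_theta (D_theta \<phi>1) r t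
        - 1 / r\<^sup>2 * \<phi>1 r t + 8 / (1 + r\<^sup>2)\<^sup>2 * \<phi>1 r t
        - 2 * (r\<^sup>2 - 1) / (r\<^sup>2 * (r\<^sup>2 + 1)) * D_theta \<phi>2 r t = 0
    \<and> D_rho (D_rho \<phi>2) r t + 1 / r * D_rho \<phi>2 r t + 1 / r\<^sup>2 * D_theta (D_theta \<phi>2) r t
        - 1 / r\<^sup>2 * \<phi>2 r t + 8 / (1 + r\<^sup>2)\<^sup>2 * \<phi>2 r t
        + 2 * (r\<^sup>2 - 1) / (r\<^sup>2 * (r\<^sup>2 + 1)) * D_theta \<phi>1 r t = 0
    \<and> D_rho (D_rho \<phi>3) r t + 1 / r * D_rho \<phi>3 r t + 1 / r\<^sup>2 * D_theta (D_theta \<phi>3) r t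
        + 8 / (1 + r\<^sup>2)\<^sup>2 * \<phi>3 r t = 0"
    unfolding coeff
    \<comment> \<open>With \<open>1 / r\<close> as an independent quantity \<open>inverse r\<close>, each equation is a polynomial
      consequence of one component of the kernel equation and \<open>s\<^sup>2 + c\<^sup>2 = 1\<close>.\<close>
    apply (simp only: derivs s_def[symmetric] divide_inverse power_inverse[symmetric])
    apply (intro conjI)
    subgoal using K(1)[unfolded divide_inverse power_inverse[symmetric]] s_sq by algebra
    subgoal using K(2)[unfolded divide_inverse power_inverse[symmetric]] s_sq by algebra
    subgoal using K(3)[unfolded divide_inverse power_inverse[symmetric]] s_sq by algebra
    done
qed

end
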